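(* Let $n,k\ge1$ and let $H$ be an $n$-qubit $k$-local Hamiltonian, i.e. $H=\sum_{P\in\{I,X,Y,Z\}^{\otimes n}:|P|\le k}\alpha_P P$ with $\alpha_P\in\mathbb{R}$. Then $$\frac13\,C(k)\,\|H\|_{\mathrm{Pauli},\frac{2k}{k+1}}\le\|H\|,\qquad C(k)=\frac{\sqrt{2(k!)}}{2\,k^{\,k+1.5+(k+1)/(2k)}\,(\sqrt6+2\sqrt3)^k}.$$
   Context: $\{I,X,Y,Z\}^{\otimes n}$ is the set of $n$-qubit Pauli observables $P=P_1\otimes\cdots\otimes P_n$; $|P|$ is the number of $i$ with $P_i\neq I$. $\|H\|$ is the spectral norm. For $H=\sum_P\alpha_P P$ and $p\ge1$, the Pauli-$p$ norm is $\|H\|_{\mathrm{Pauli},p}=\big(\sum_P|\alpha_P|^p\big)^{1/p}$. *)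

theory Defs
  imports "HOL-Analysis.Analysis"
begin

datatype pauli = PI | PX | PY | PZ

instance pauli :: finite
proof
  have "(UNIV :: pauli set) \<subseteq> {PI, PX, PY, PZ}"
    using pauli.exhaust by blast
  then show "finite (UNIV :: pauli set)"
    by (rule finite_subset) simp
qed

text \<open>
  Rows and columns of a qubit operator are indexed by bool, with False for \<open>|0>\<close> and True
  for \<open>|1>\<close>; the first index is the row.
\<close>

fun pauli_matrix :: "pauli \<Rightarrow> complex ^ bool ^ bool" where
  "pauli_matrix PI = mat 1"
| "pauli_matrix PX = (\<chi> a b. if a = b then 0 else 1)"
| "pauli_matrix PY = (\<chi> a b. if a = b then 0 else if a then \<i> else - \<i>)"
| "pauli_matrix PZ = (\<chi> a b. if a \<noteq> b then 0 else if a then - 1 else 1)"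

text \<open>
  The qubits are labelled by a finite type \<open>'n\<close>, so their number is \<open>CARD('n)\<close>, which is
  arbitrary and at least 1. The computational basis of the state space is indexed by the bit
  strings \<open>'n \<Rightarrow> bool\<close>, and a tensor product of single-qubit matrices has as its entries the
  products of the entries of the factors.
\<close>

type_synonym 'n operator = "complex ^ ('n \<Rightarrow> bool) ^ ('n \<Rightarrow> bool)"

definition pauli_op :: "('n::finite \<Rightarrow> pauli) \<Rightarrow> 'n operator" where
  "pauli_op P = (\<chi> x y. \<Prod>i\<in>UNIV. pauli_matrix (P i) $ x i $ y i)"

definition pauli_weight :: "('n::finite \<Rightarrow> pauli) \<Rightarrow> nat" where
  "pauli_weight P = card {i. P i \<noteq> PI}"

definition local_hamiltonian :: "nat \<Rightarrow> 'n::finite operator \<Rightarrow> bool" where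
  "local_hamiltonian k H \<longleftrightarrow>
    (\<exists>\<alpha> :: ('n \<Rightarrow> pauli) \<Rightarrow> real. H = (\<Sum>P | pauli_weight P \<le> k. \<alpha> P *\<^sub>R pauli_op P))"

text \<open>
  The coefficients are unique by \<open>pauli_coeff_sum\<close> below; for an operator that is not a
  real combination of Pauli observables the value is unspecified.
\<close>

definition pauli_coeff :: "'n::finite operator \<Rightarrow> ('n \<Rightarrow> pauli) \<Rightarrow> real" where
  "pauli_coeff H = (THE \<alpha>. H = (\<Sum>P\<in>UNIV. \<alpha> P *\<^sub>R pauli_op P))"

definition pauli_norm :: "real \<Rightarrow> 'n::finite operator \<Rightarrow> real" where
  "pauli_norm p H = (\<Sum>P\<in>UNIV. \<bar>pauli_coeff H P\<bar> powr p) powr (1 / p)"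

text \<open>The vector norm on \<open>complex ^ 'm\<close> is the Euclidean one.\<close>

definition spectral_norm :: "'n::finite operator \<Rightarrow> real" where
  "spectral_norm H = onorm (\<lambda>v. H *v v)"

definition pauli_const :: "nat \<Rightarrow> real" where
  "pauli_const k =
    sqrt (2 * fact k) /
    (2 * real k powr (real k + 3 / 2 + (real k + 1) / (2 * real k)) * (sqrt 6 + 2 * sqrt 3) ^ k)"

lemma pauli_matrix_orthogonal:
  "(\<Sum>a\<in>UNIV. \<Sum>b\<in>UNIV. pauli_matrix p $ a $ b * pauli_matrix q $ b $ a) = (if p = q then 2 else 0)"
  by (cases p; cases q) (simp_all add: UNIV_bool mat_def)

lemma pauli_op_orthogonal:
  fixes P Q :: "'n::finite \<Rightarrow> pauli"
  shows "(\<Sum>x\<in>UNIV. \<Sum>y\<in>UNIV. pauli_op P $ x $ y * pauli_op Q $ y $ x) =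
    (if P = Q then 2 ^ CARD('n) else 0)"
proof -
  have "(\<Sum>x\<in>UNIV. \<Sum>y\<in>UNIV. pauli_op P $ x $ y * pauli_op Q $ y $ x) =
      (\<Sum>x\<in>UNIV. \<Sum>y\<in>UNIV. \<Prod>i\<in>UNIV.
        pauli_matrix (P i) $ x i $ y i * pauli_matrix (Q i) $ y i $ x i)"
    by (simp add: pauli_op_def prod.distrib)
  also have "\<dots> = (\<Sum>x\<in>UNIV. \<Prod>i\<in>UNIV. \<Sum>b\<in>UNIV.
        pauli_matrix (P i) $ x i $ b * pauli_matrix (Q i) $ b $ x i)"
    by (subst prod_sum_PiE) (simp_all add: PiE_UNIV_domain)
  also have "\<dots> = (\<Prod>i\<in>UNIV. \<Sum>a\<in>UNIV. \<Sum>b\<in>UNIV.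
        pauli_matrix (P i) $ a $ b * pauli_matrix (Q i) $ b $ a)"
    by (subst prod_sum_PiE) (simp_all add: PiE_UNIV_domain)
  also have "\<dots> = (\<Prod>i\<in>UNIV. if P i = Q i then 2 else 0)"
    by (simp only: pauli_matrix_orthogonal)
  also have "\<dots> = (if P = Q then 2 ^ CARD('n) else 0)"
    by (auto simp: fun_eq_iff)
  finally show ?thesis .
qed

lemma trace_pauli_sum:
  fixes \<alpha> :: "('n::finite \<Rightarrow> pauli) \<Rightarrow> real"
  shows "(\<Sum>x\<in>UNIV. \<Sum>y\<in>UNIV. (\<Sum>P\<in>UNIV. \<alpha> P *\<^sub>R pauli_op P) $ x $ y * pauli_op Q $ y $ x) =
    of_real (\<alpha> Q) * 2 ^ CARD('n)"
proof -
  have "(\<Sum>x\<in>UNIV. \<Sum>y\<in>UNIV. (\<Sum>P\<in>UNIV. \<alpha> P *\<^sub>R pauli_op P) $ x $ y * pauli_op Q $ y $ x) =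
      (\<Sum>x\<in>UNIV. \<Sum>y\<in>UNIV. \<Sum>P\<in>UNIV. of_real (\<alpha> P) * (pauli_op P $ x $ y * pauli_op Q $ y $ x))"
    by (simp add: sum_distrib_right scaleR_conv_of_real [where 'a = complex] mult.assoc)
  also have "\<dots> = (\<Sum>x\<in>UNIV. \<Sum>P\<in>UNIV. \<Sum>y\<in>UNIV.
      of_real (\<alpha> P) * (pauli_op P $ x $ y * pauli_op Q $ y $ x))"
    by (intro sum.cong refl sum.swap)
  also have "\<dots> = (\<Sum>P\<in>UNIV. \<Sum>x\<in>UNIV. \<Sum>y\<in>UNIV.
      of_real (\<alpha> P) * (pauli_op P $ x $ y * pauli_op Q $ y $ x))"
    by (rule sum.swap)
  also have "\<dots> = (\<Sum>P\<in>UNIV. of_real (\<alpha> P) * (if P = Q then 2 ^ CARD('n) else 0))"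
    by (simp only: sum_distrib_left [symmetric] pauli_op_orthogonal)
  also have "\<dots> = of_real (\<alpha> Q) * 2 ^ CARD('n)"
    by (simp add: if_distrib cong: if_cong)
  finally show ?thesis .
qed

lemma pauli_coeff_sum:
  fixes \<alpha> :: "('n::finite \<Rightarrow> pauli) \<Rightarrow> real"
  shows "pauli_coeff (\<Sum>P\<in>UNIV. \<alpha> P *\<^sub>R pauli_op P) = \<alpha>"
  unfolding pauli_coeff_def
proof (rule the_equality)
  fix \<beta> :: "('n \<Rightarrow> pauli) \<Rightarrow> real"
  assume eq: "(\<Sum>P\<in>UNIV. \<alpha> P *\<^sub>R pauli_op P) = (\<Sum>P\<in>UNIV. \<beta> P *\<^sub>R pauli_op P)"
  show "\<beta> = \<alpha>"
  proof
    fix Q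
    show "\<beta> Q = \<alpha> Q"
      using trace_pauli_sum [of \<alpha> Q] trace_pauli_sum [of \<beta> Q] eq by simp
  qed
qed simp

end

theory Submission
  imports Defs "HOL-Computational_Algebra.Polynomial"
begin

text \<open>
  At each qubit take the pure state with Bloch vector \<open>s / sqrt 3\<close>, \<open>s \<in> {- 1, 1}\<^sup>3\<close>. The
  expectation of \<open>H\<close> in such product states is a multiaffine polynomial of degree at most \<open>k\<close> on
  the cube \<open>{- 1, 1}\<^sup>3\<^sup>n\<close>, bounded by \<open>\<parallel>H\<parallel>\<close>, with coefficients \<open>\<alpha> P / sqrt 3 ^ |P|\<close>, so a
  Bohnenblust--Hille inequality for the cube suffices. Let \<open>L i\<close> be the \<open>l2\<close> norm of the
  coefficients of the \<open>i\<close>-th partial derivative. A polynomial in one variable bounded on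
  \<open>[- 1, 1]\<close> has a bounded linear coefficient; applied to \<open>t \<mapsto> f ((x + t y) / 2)\<close> this bounds
  \<open>\<Sum>i. \<bar>\<partial>\<^sub>i f (x / 2)\<bar>\<close>, hence by hypercontractivity (comparison of \<open>L2\<close> and \<open>L1\<close>) also
  \<open>\<Sum>i. L i\<close>. If that sum is at most \<open>1\<close>, then with \<open>m = Min (L ` S)\<close> each coefficient satisfies
  \<open>\<bar>a S\<bar> powr (2 k / (k + 1)) \<le> (a S)\<^sup>2 / m + m ^ k\<close>, and both terms can be summed over \<open>S\<close>.
\<close>

subsection \<open>Multiaffine polynomials on the discrete cube\<close>

text \<open>Cube points are encoded by the set of coordinates equal to -1, so sums over points and
  sums over coefficients both run over \<open>Pow V\<close> and split by
  \<open>sum_Pow_insert\<close>.\<close>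

definition vertex :: "'v set \<Rightarrow> 'v \<Rightarrow> real" where
  "vertex X i = (if i \<in> X then - 1 else 1)"

definition multiaffine :: "('v set \<Rightarrow> real) \<Rightarrow> 'v set \<Rightarrow> ('v \<Rightarrow> real) \<Rightarrow> real" where
  "multiaffine a V x = (\<Sum>S\<in>Pow V. a S * (\<Prod>i\<in>S. x i))"

definition cube_mean :: "'v set \<Rightarrow> ('v set \<Rightarrow> real) \<Rightarrow> real" where
  "cube_mean V F = (\<Sum>X\<in>Pow V. F X) / 2 ^ card V"

lemma sum_Pow_insert:
  fixes F :: "'v set \<Rightarrow> 'a::comm_monoid_add"
  assumes "finite V" "i \<notin> V"
  shows "(\<Sum>S\<in>Pow (insert i V). F S) = (\<Sum>S\<in>Pow V. F S + F (insert i S))"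
proof -
  have inj: "inj_on (insert i) (Pow V)"
    using assms(2) by (auto simp: inj_on_def)
  have "Pow V \<inter> insert i ` Pow V = {}"
    using assms(2) by auto
  then have "(\<Sum>S\<in>Pow (insert i V). F S) = (\<Sum>S\<in>Pow V. F S) + (\<Sum>S\<in>insert i ` Pow V. F S)"
    unfolding Pow_insert using assms(1) by (intro sum.union_disjoint) auto
  then show ?thesis
    using inj by (simp add: sum.reindex sum.distrib)
qed

lemma multiaffine_empty [simp]: "multiaffine a {} x = a {}"
  by (simp add: multiaffine_def)

lemma multiaffine_insert:
  assumes "finite V" "i \<notin> V"
  shows "multiaffine a (insert i V) x = multiaffine a V x + x i * multiaffine (\<lambda>S. a (insert i S)) V x"
proof -
  have "(\<Prod>j\<in>insert i S. x j) = x i * (\<Prod>j\<in>S. x j)" if "S \<in> Pow V" for S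
    using that assms finite_subset[of S V] by (intro prod.insert) auto
  then show ?thesis
    unfolding multiaffine_def sum_Pow_insert[OF assms] sum_distrib_left sum.distrib
    by (simp add: algebra_simps)
qed

lemma multiaffine_cong:
  assumes "\<And>i. i \<in> V \<Longrightarrow> x i = y i"
  shows "multiaffine a V x = multiaffine a V y"
  unfolding multiaffine_def using assms by (intro sum.cong refl arg_cong2[of _ _ _ _ "(*)"] prod.cong) auto

lemma multiaffine_vertex_insert:
  assumes "i \<notin> V"
  shows "multiaffine a V (vertex (insert i X)) = multiaffine a V (vertex X)"
  using assms by (intro multiaffine_cong) (auto simp: vertex_def)

lemma cube_mean_empty [simp]: "cube_mean {} F = F {}"
  by (simp add: cube_mean_def)

text \<open>Averages over the coordinate \<open>i\<close> alone: with f = u + x_i v, the two values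
  of x_i give u + v and u - v. The inductions for second and fourth moments rest on this.\<close>

lemma cube_mean_multiaffine_insert:
  assumes "finite V" "i \<notin> V"
  shows "cube_mean (insert i V) (\<lambda>X. F (multiaffine a (insert i V) (vertex X))) =
    cube_mean V (\<lambda>X.
      (F (multiaffine a V (vertex X) + multiaffine (\<lambda>S. a (insert i S)) V (vertex X)) +
       F (multiaffine a V (vertex X) - multiaffine (\<lambda>S. a (insert i S)) V (vertex X))) / 2)"
proof -
  have "vertex X i = 1" "vertex (insert i X) i = -1" if "X \<in> Pow V" for X
    using that assms(2) by (auto simp: vertex_def)
  then show ?thesis
    unfolding cube_mean_def sum_Pow_insert[OF assms] multiaffine_insert[OF assms]
      multiaffine_vertex_insert[OF assms(2)] sum_divide_distrib
    using assms by (intro sum.cong refl) (simp add: field_simps)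
qed

lemma cube_mean_add: "cube_mean V (\<lambda>X. F X + G X) = cube_mean V F + cube_mean V G"
  by (simp add: cube_mean_def sum.distrib add_divide_distrib)

lemma cube_mean_cmult: "cube_mean V (\<lambda>X. c * F X) = c * cube_mean V F"
  by (simp add: cube_mean_def sum_distrib_left)

lemma cube_mean_sum: "cube_mean V (\<lambda>X. \<Sum>i\<in>I. F i X) = (\<Sum>i\<in>I. cube_mean V (F i))"
  unfolding cube_mean_def by (subst sum.swap) (simp add: sum_divide_distrib)

lemma cube_mean_mono:
  assumes "\<And>X. X \<in> Pow V \<Longrightarrow> F X \<le> G X"
  shows "cube_mean V F \<le> cube_mean V G"
  unfolding cube_mean_def using assms by (intro divide_right_mono sum_mono) auto

lemma cube_mean_const: "finite V \<Longrightarrow> cube_mean V (\<lambda>X. c) = c"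
  by (simp add: cube_mean_def card_Pow)

lemma cube_mean_nonneg:
  assumes "\<And>X. 0 \<le> F X"
  shows "0 \<le> cube_mean V F"
  unfolding cube_mean_def using assms by (intro divide_nonneg_nonneg sum_nonneg) auto

lemma cube_mean_Cauchy_Schwarz:
  "(cube_mean V (\<lambda>X. F X * G X))\<^sup>2 \<le> cube_mean V (\<lambda>X. (F X)\<^sup>2) * cube_mean V (\<lambda>X. (G X)\<^sup>2)"
  using Cauchy_Schwarz_ineq_sum[of F G "Pow V"]
  by (simp add: cube_mean_def power_divide power2_eq_square divide_right_mono)

lemma parseval:
  assumes "finite V"
  shows "cube_mean V (\<lambda>X. (multiaffine a V (vertex X))\<^sup>2) = (\<Sum>S\<in>Pow V. (a S)\<^sup>2)"
  using assms
proof (induction V arbitrary: a)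
  case (insert i V)
  have eq: "((u + v)\<^sup>2 + (u - v)\<^sup>2) / 2 = u\<^sup>2 + v\<^sup>2" for u v :: real
    by (simp add: power2_eq_square algebra_simps)
  show ?case
    unfolding cube_mean_multiaffine_insert[OF insert.hyps, of "\<lambda>t. t\<^sup>2"] eq cube_mean_add insert.IH
      sum_Pow_insert[OF insert.hyps] sum.distrib ..
qed simp

section \<open>Hypercontractivity and comparison of moments\<close>

lemma multiaffine_zero: "(\<And>S. S \<subseteq> V \<Longrightarrow> a S = 0) \<Longrightarrow> multiaffine a V x = 0"
  unfolding multiaffine_def by (intro sum.neutral) auto

text \<open>Bonami's lemma. Writing f = u + x_i v, only even powers of v survive the average over
  x_i; the mixed term is handled by Cauchy-Schwarz, and v has degree at most d - 1, which saves a
  factor 9.\<close>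

lemma multiaffine_hypercontractive:
  assumes "finite V" "\<And>S. S \<subseteq> V \<Longrightarrow> a S \<noteq> 0 \<Longrightarrow> card S \<le> d"
  shows "cube_mean V (\<lambda>X. (multiaffine a V (vertex X)) ^ 4) \<le>
    9 ^ d * (cube_mean V (\<lambda>X. (multiaffine a V (vertex X))\<^sup>2))\<^sup>2"
  using assms
proof (induction V arbitrary: a d)
  case empty
  have "1 * (a {}) ^ 4 \<le> 9 ^ d * (a {}) ^ 4"
    by (intro mult_right_mono) auto
  then show ?case
    by (simp flip: power_mult)
next
  case (insert i V)
  let ?b = "\<lambda>S. a (insert i S)"
  let ?u = "\<lambda>X. multiaffine a V (vertex X)" and ?v = "\<lambda>X. multiaffine ?b V (vertex X)"
  let ?m = "cube_mean V"
  define U W where "U = ?m (\<lambda>X. (?u X)\<^sup>2)" and "W = ?m (\<lambda>X. (?v X)\<^sup>2)"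
  have nn: "0 \<le> U" "0 \<le> W"
    by (auto simp: U_def W_def intro!: cube_mean_nonneg)
  have eq4: "((u + v) ^ 4 + (u - v) ^ 4) / 2 = u ^ 4 + 6 * (u\<^sup>2 * v\<^sup>2) + v ^ 4" for u v :: real
    by (simp add: power4_eq_xxxx power2_eq_square algebra_simps)
  have eq2: "((u + v)\<^sup>2 + (u - v)\<^sup>2) / 2 = u\<^sup>2 + v\<^sup>2" for u v :: real
    by (simp add: power2_eq_square algebra_simps)
  have L: "cube_mean (insert i V) (\<lambda>X. (multiaffine a (insert i V) (vertex X)) ^ 4) =
      ?m (\<lambda>X. ?u X ^ 4) + 6 * ?m (\<lambda>X. (?u X)\<^sup>2 * (?v X)\<^sup>2) + ?m (\<lambda>X. ?v X ^ 4)"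
    unfolding cube_mean_multiaffine_insert[OF insert.hyps, of "\<lambda>t. t ^ 4"] eq4
      cube_mean_add cube_mean_cmult ..
  have R: "cube_mean (insert i V) (\<lambda>X. (multiaffine a (insert i V) (vertex X))\<^sup>2) = U + W"
    unfolding cube_mean_multiaffine_insert[OF insert.hyps, of "\<lambda>t. t\<^sup>2"] eq2
      cube_mean_add U_def W_def ..
  have u: "?m (\<lambda>X. ?u X ^ 4) \<le> 9 ^ d * U\<^sup>2"
    unfolding U_def using insert.prems by (intro insert.IH) auto
  have card: "Suc (card S) \<le> d" if "S \<subseteq> V" "?b S \<noteq> 0" for S
  proof -
    have "finite S" "i \<notin> S"
      using that insert.hyps finite_subset[of S V] by auto
    then show ?thesis
      using insert.prems[of "insert i S"] that by auto
  qed
  show ?case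
  proof (cases d)
    \<comment> \<open>Degree 0 leaves no monomial containing \<open>i\<close>, so v vanishes and
      there is no \<open>d - 1\<close> to recurse on.\<close>
    case 0
    then have "?v X = 0" for X
      using card by (intro multiaffine_zero) force
    then show ?thesis
      using u unfolding L R W_def by (simp add: cube_mean_def)
  next
    case (Suc e)
    have v: "?m (\<lambda>X. ?v X ^ 4) \<le> 9 ^ e * W\<^sup>2"
      unfolding W_def using card Suc by (intro insert.IH) auto
    have "(?m (\<lambda>X. (?u X)\<^sup>2 * (?v X)\<^sup>2))\<^sup>2 \<le> ?m (\<lambda>X. ?u X ^ 4) * ?m (\<lambda>X. ?v X ^ 4)"
      using cube_mean_Cauchy_Schwarz[of V "\<lambda>X. (?u X)\<^sup>2" "\<lambda>X. (?v X)\<^sup>2"] by (simp flip: power_mult)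
    also have "\<dots> \<le> (9 ^ d * U\<^sup>2) * (9 ^ e * W\<^sup>2)"
      using u v by (intro mult_mono) (auto intro!: cube_mean_nonneg)
    also have "\<dots> = (3 * 9 ^ e * (U * W))\<^sup>2"
      by (simp add: Suc power2_eq_square)
    finally have uv: "?m (\<lambda>X. (?u X)\<^sup>2 * (?v X)\<^sup>2) \<le> 3 * 9 ^ e * (U * W)"
      using nn by (auto intro: power2_le_imp_le)
    \<comment> \<open>The 18 is 6 (binomial coefficient) times 3 (from \<open>uv\<close>), exactly
      the mixed coefficient of 9 (U + W)^2.\<close>
    have "9 ^ e * (9 * U\<^sup>2 + 18 * (U * W) + W\<^sup>2) \<le> 9 ^ e * (9 * (U + W)\<^sup>2)"
      by (intro mult_left_mono) (auto simp: power2_eq_square algebra_simps)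
    then show ?thesis
      using u v uv unfolding L R by (simp add: Suc algebra_simps)
  qed
qed

text \<open>Interpolates the second moment between the first and the fourth by two applications of
  Cauchy-Schwarz; the fourth moment is then removed by hypercontractivity.\<close>

lemma multiaffine_l2_le_l1:
  assumes "finite V" "\<And>S. S \<subseteq> V \<Longrightarrow> a S \<noteq> 0 \<Longrightarrow> card S \<le> d"
  shows "sqrt (\<Sum>S\<in>Pow V. (a S)\<^sup>2) \<le> 3 ^ d * cube_mean V (\<lambda>X. \<bar>multiaffine a V (vertex X)\<bar>)"
proof -
  let ?g = "\<lambda>X. multiaffine a V (vertex X)"
  define M where "M n = cube_mean V (\<lambda>X. \<bar>?g X\<bar> ^ n)" for n
  have nn: "0 \<le> M n" for n
    by (auto simp: M_def intro!: cube_mean_nonneg)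
  have odd: "\<bar>t\<bar> ^ 2 = t ^ 2" "\<bar>t\<bar> ^ 4 = t ^ 4" for t :: real
    by auto
  have s: "(sqrt \<bar>t\<bar>)\<^sup>2 = \<bar>t\<bar> ^ 1" "sqrt \<bar>t\<bar> * (sqrt \<bar>t\<bar> * \<bar>t\<bar>) = \<bar>t\<bar> ^ 2"
    "(sqrt \<bar>t\<bar> * \<bar>t\<bar>)\<^sup>2 = \<bar>t\<bar> ^ 3" for t :: real
    using real_sqrt_mult_self[of "\<bar>t\<bar>"]
    by (simp_all only: power_mult_distrib power3_eq_cube power2_eq_square abs_idempotent mult_ac power_one_right)
  have s': "\<bar>t\<bar> * \<bar>t\<bar>\<^sup>2 = \<bar>t\<bar> ^ 3" "(\<bar>t\<bar>\<^sup>2)\<^sup>2 = \<bar>t\<bar> ^ 4" for t :: real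
    by (simp_all add: eval_nat_numeral)
  have m1: "(M 2)\<^sup>2 \<le> M 1 * M 3"
    using cube_mean_Cauchy_Schwarz[of V "\<lambda>X. sqrt \<bar>?g X\<bar>" "\<lambda>X. sqrt \<bar>?g X\<bar> * \<bar>?g X\<bar>"]
    unfolding M_def s .
  have m2: "(M 3)\<^sup>2 \<le> M 2 * M 4"
    using cube_mean_Cauchy_Schwarz[of V "\<lambda>X. \<bar>?g X\<bar>" "\<lambda>X. \<bar>?g X\<bar>\<^sup>2"]
    unfolding M_def s' .
  have m4: "M 4 \<le> 9 ^ d * (M 2)\<^sup>2"
    using multiaffine_hypercontractive[OF assms] by (simp add: M_def odd)
  \<comment> \<open>Chain: M2^4 \<le> M1^2 M3^2 \<le> M1^2 M2 M4 \<le> 9^d M1^2 M2^3, after which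
    M2^3 cancels.\<close>
  have "(M 2) ^ 4 = ((M 2)\<^sup>2)\<^sup>2"
    by simp
  also have "\<dots> \<le> (M 1 * M 3)\<^sup>2"
    by (intro power_mono m1) auto
  also have "\<dots> \<le> (M 1)\<^sup>2 * (M 2 * M 4)"
    unfolding power_mult_distrib by (intro mult_left_mono m2) auto
  also have "\<dots> \<le> (M 1)\<^sup>2 * (M 2 * (9 ^ d * (M 2)\<^sup>2))"
    by (intro mult_left_mono m4) (auto simp: nn)
  finally have "(M 2) ^ 3 * M 2 \<le> (M 2) ^ 3 * (9 ^ d * (M 1)\<^sup>2)"
    by (simp add: eval_nat_numeral mult_ac)
  then have "M 2 \<le> 9 ^ d * (M 1)\<^sup>2"
    using nn[of 2] by (cases "M 2 = 0") (auto simp: mult_le_cancel_left)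
  also have "9 ^ d = (3 ^ d :: real)\<^sup>2"
    by (simp add: power2_eq_square flip: power_mult_distrib)
  also have "(3 ^ d)\<^sup>2 * (M 1)\<^sup>2 = (3 ^ d * M 1)\<^sup>2"
    by (simp add: power_mult_distrib)
  finally have "sqrt (M 2) \<le> 3 ^ d * M 1"
    using nn[of 1] real_le_lsqrt by (simp add: real_sqrt_le_iff real_le_lsqrt)
  then show ?thesis
    using parseval[OF assms(1), of a] by (simp add: M_def)
qed

text \<open>A function affine in each variable takes its extreme values on a box at the
  vertices.\<close>

lemma multiaffine_bounded:
  assumes "finite V" "\<And>X. X \<subseteq> V \<Longrightarrow> \<bar>multiaffine a V (vertex X)\<bar> \<le> B"
    "\<And>i. i \<in> V \<Longrightarrow> \<bar>x i\<bar> \<le> 1"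
  shows "\<bar>multiaffine a V x\<bar> \<le> B"
  using assms
proof (induction V arbitrary: a)
  case empty
  then show ?case by simp
next
  case (insert i V)
  \<comment> \<open>Freezing the coordinate \<open>i\<close> at \<open>x i\<close> gives a
    polynomial in the other variables whose vertex values lie between u - v and u + v.\<close>
  let ?b = "\<lambda>S. a S + x i * a (insert i S)"
  have eq: "multiaffine ?b V y = multiaffine a V y + x i * multiaffine (\<lambda>S. a (insert i S)) V y" for y
    by (simp add: multiaffine_def algebra_simps sum.distrib sum_distrib_left)
  have "\<bar>multiaffine ?b V (vertex X)\<bar> \<le> B" if "X \<subseteq> V" for X
  proof -
    let ?u = "multiaffine a V (vertex X)" and ?v = "multiaffine (\<lambda>S. a (insert i S)) V (vertex X)"
    have "vertex X i = 1" "vertex (insert i X) i = -1"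
      using that insert.hyps by (auto simp: vertex_def)
    then have "\<bar>?u + ?v\<bar> \<le> B" "\<bar>?u - ?v\<bar> \<le> B"
      using insert.prems(1)[of X] insert.prems(1)[of "insert i X"] that insert.hyps
      by (auto simp: multiaffine_insert multiaffine_vertex_insert)
    moreover have "\<bar>x i * ?v\<bar> \<le> \<bar>?v\<bar>"
      using insert.prems(2)[of i] by (simp add: abs_mult mult_left_le_one_le)
    ultimately show ?thesis
      unfolding eq by linarith
  qed
  then show ?case
    using insert.IH[of ?b] insert.prems(2) by (simp add: eq multiaffine_insert insert.hyps)
qed

subsection \<open>A Bohnenblust--Hille inequality\<close>

text \<open>The combination of \<open>q (t / 2)\<close> and \<open>q t\<close> that cancels the top degree keeps the linear coefficient.\<close>

lemma linear_coeff_bound: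
  fixes c :: "nat \<Rightarrow> real"
  assumes "\<And>t. \<bar>t\<bar> \<le> 1 \<Longrightarrow> \<bar>\<Sum>d\<le>n + 2. c d * t ^ d\<bar> \<le> B"
  shows "\<bar>c 1\<bar> \<le> 3 ^ n * B"
  using assms
proof (induction n arbitrary: c B)
  case 0
  \<comment> \<open>For degree at most 2 the difference of the values at 1 and -1 is twice the
    linear coefficient.\<close>
  from 0[of 1] 0[of "-1"] show ?case
    by (simp add: eval_nat_numeral abs_le_iff)
next
  case (Suc n)
  let ?q = "2 ^ (n + 3) :: real"
  \<comment> \<open>The value 8 is the threshold for q + 1 \<le> 3 (q / 2 - 1), which makes each
    reduction of the degree cost a factor 3.\<close>
  have q: "?q \<ge> 8"
    using power_increasing[of 3 "n + 3" "2 :: real"] by simp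
  define c' where "c' d = c d * (?q / 2 ^ d - 1) / (?q / 2 - 1)" for d
  have "\<bar>\<Sum>d\<le>n + 2. c' d * t ^ d\<bar> \<le> 3 * B" if t: "\<bar>t\<bar> \<le> 1" for t
  proof -
    have "(\<Sum>d\<le>n + 2. c' d * t ^ d) = (\<Sum>d\<le>Suc n + 2. c' d * t ^ d)"
      by (simp add: c'_def numeral_eq_Suc)
    also have "\<dots> = (\<Sum>d\<le>Suc n + 2. ?q * (c d * (t / 2) ^ d) - c d * t ^ d) / (?q / 2 - 1)"
      unfolding sum_divide_distrib
      by (intro sum.cong refl) (simp add: c'_def power_divide algebra_simps)
    also have "\<dots> = (?q * (\<Sum>d\<le>Suc n + 2. c d * (t / 2) ^ d) - (\<Sum>d\<le>Suc n + 2. c d * t ^ d)) / (?q / 2 - 1)"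
      by (simp only: sum_subtractf sum_distrib_left)
    finally have eq: "(\<Sum>d\<le>n + 2. c' d * t ^ d) = \<dots>" .
    have "\<bar>?q * (\<Sum>d\<le>Suc n + 2. c d * (t / 2) ^ d)\<bar> \<le> ?q * B"
      unfolding abs_mult using Suc.prems[of "t / 2"] t by (intro mult_mono) auto
    moreover have "\<bar>\<Sum>d\<le>Suc n + 2. c d * t ^ d\<bar> \<le> B"
      by (rule Suc.prems[OF t])
    ultimately have "\<bar>?q * (\<Sum>d\<le>Suc n + 2. c d * (t / 2) ^ d) - (\<Sum>d\<le>Suc n + 2. c d * t ^ d)\<bar> \<le> (?q + 1) * B"
      unfolding distrib_right by linarith
    also have "\<dots> \<le> 3 * (?q / 2 - 1) * B"
      using q Suc.prems[of 0] by (intro mult_right_mono) auto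
    finally show ?thesis
      unfolding eq abs_divide using q by (simp add: divide_le_eq mult_ac)
  qed
  from Suc.IH[OF this] have "\<bar>c' 1\<bar> \<le> 3 ^ Suc n * B"
    by simp
  then show ?case
    using q by (simp add: c'_def)
qed

text \<open>The polynomial is padded to degree (k - 1) + 2 = k + 1, so that k = 1 is covered by the
  base case of \<open>linear_coeff_bound\<close>.\<close>

lemma deriv_bound:
  fixes p :: "real poly"
  assumes "degree p \<le> k" "k \<ge> 1" "\<And>t. \<bar>t\<bar> \<le> 1 \<Longrightarrow> \<bar>poly p t\<bar> \<le> B"
  shows "\<bar>poly (pderiv p) 0\<bar> \<le> 3 ^ (k - 1) * B"
proof -
  have "poly p t = (\<Sum>d\<le>(k - 1) + 2. coeff p d * t ^ d)" for t
    unfolding poly_altdef using assms(1)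
    by (intro sum.mono_neutral_left) (auto simp: coeff_eq_0)
  then have "\<bar>coeff p 1\<bar> \<le> 3 ^ (k - 1) * B"
    using assms(3) by (intro linear_coeff_bound) auto
  then show ?thesis
    by (simp add: poly_0_coeff_0 coeff_pderiv)
qed

section \<open>Partial derivatives and the sum of the influences\<close>

definition influence :: "('v set \<Rightarrow> real) \<Rightarrow> 'v set \<Rightarrow> 'v \<Rightarrow> real" where
  "influence a V i = sqrt (\<Sum>T | T \<subseteq> V \<and> i \<in> T. (a T)\<^sup>2)"

text \<open>
  The point \<open>x / 2\<close> leaves room for the segment through it in a direction \<open>y / 2\<close>; the
  factors \<open>1 / 2\<close> are put into the coefficients.
\<close>

definition halved_partial :: "('v set \<Rightarrow> real) \<Rightarrow> 'v \<Rightarrow> 'v set \<Rightarrow> real" where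
  "halved_partial a i S = (if i \<in> S then 0 else a (insert i S) * (1 / 2) ^ card S)"

text \<open>Reindexing by T = S with \<open>i\<close> added; the condition on \<open>F\<close>
  discards the sets S that already contain \<open>i\<close>. It serves both the values of the
  polynomial and its sum of squares.\<close>

lemma sum_halved_partial:
  fixes F :: "'v set \<Rightarrow> real \<Rightarrow> real"
  assumes "finite V" "i \<in> V" "\<And>S. F S 0 = 0"
  shows "(\<Sum>S\<in>Pow V. F S (halved_partial a i S)) =
    (\<Sum>T | T \<subseteq> V \<and> i \<in> T. F (T - {i}) (a T * (1 / 2) ^ card (T - {i})))"
proof -
  have "(\<Sum>S\<in>Pow V. F S (halved_partial a i S)) = (\<Sum>S | S \<subseteq> V \<and> i \<notin> S. F S (halved_partial a i S))"
    using assms by (intro sum.mono_neutral_right) (auto simp: halved_partial_def)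
  also have "\<dots> = (\<Sum>T | T \<subseteq> V \<and> i \<in> T. F (T - {i}) (a T * (1 / 2) ^ card (T - {i})))"
    using assms(2)
    by (intro sum.reindex_bij_witness[of _ "\<lambda>T. T - {i}" "insert i"])
       (auto simp: halved_partial_def insert_absorb)
  finally show ?thesis .
qed

lemma multiaffine_halved_partial:
  assumes "finite V" "i \<in> V"
  shows "multiaffine (halved_partial a i) V x = (\<Sum>T | T \<subseteq> V \<and> i \<in> T. a T * (\<Prod>j\<in>T - {i}. x j / 2))"
  unfolding multiaffine_def
  by (subst sum_halved_partial[OF assms])
     (simp_all add: prod_dividef power_one_over)

text \<open>The sum of absolute values is twice the derivative at 0 of f((x + t y) / 2) when y holds
  the signs of the partial derivatives. This one-variable polynomial has degree at most k and is
  bounded by B.\<close>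

lemma sum_partials_bound:
  fixes x :: "'v \<Rightarrow> real"
  assumes V: "finite V" and k: "k \<ge> 1" and deg: "\<And>S. S \<subseteq> V \<Longrightarrow> a S \<noteq> 0 \<Longrightarrow> card S \<le> k"
    and B: "\<And>x. (\<And>i. i \<in> V \<Longrightarrow> \<bar>x i\<bar> \<le> 1) \<Longrightarrow> \<bar>multiaffine a V x\<bar> \<le> B"
    and x: "\<And>i. i \<in> V \<Longrightarrow> \<bar>x i\<bar> \<le> 1"
  shows "(\<Sum>i\<in>V. \<bar>multiaffine (halved_partial a i) V x\<bar>) \<le> 2 * 3 ^ (k - 1) * B"
proof -
  define D where "D i = multiaffine (halved_partial a i) V x" for i
  define y where "y i = (if D i < 0 then - 1 else 1 :: real)" for i
  define p where "p = (\<Sum>S\<in>Pow V. smult (a S) (\<Prod>i\<in>S. [:x i / 2, y i / 2:]))"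
  have fin: "finite S" if "S \<in> Pow V" for S
    using that V finite_subset by auto
  have "degree p \<le> k"
    unfolding p_def
  proof (rule degree_sum_le)
    fix S assume S: "S \<in> Pow V"
    have "degree (\<Prod>i\<in>S. [:x i / 2, y i / 2:]) \<le> (\<Sum>i\<in>S. degree [:x i / 2, y i / 2:])"
      using degree_prod_sum_le[OF fin[OF S], of "\<lambda>i. [:x i / 2, y i / 2:]"] by (simp add: o_def)
    also have "\<dots> \<le> (\<Sum>i\<in>S. 1)"
      by (intro sum_mono) simp
    finally show "degree (smult (a S) (\<Prod>i\<in>S. [:x i / 2, y i / 2:])) \<le> k"
      using deg[of S] S by (cases "a S = 0") auto
  qed (use V in auto)
  moreover have "\<bar>poly p t\<bar> \<le> B" if t: "\<bar>t\<bar> \<le> 1" for t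
  proof -
    have "poly p t = multiaffine a V (\<lambda>i. x i / 2 + t * (y i / 2))"
      by (simp add: p_def multiaffine_def poly_sum poly_prod)
    moreover have "\<bar>x i / 2 + t * (y i / 2)\<bar> \<le> 1" if "i \<in> V" for i
      using x[OF that] t by (auto simp: y_def)
    ultimately show ?thesis
      using B by simp
  qed
  ultimately have "\<bar>poly (pderiv p) 0\<bar> \<le> 3 ^ (k - 1) * B"
    using k by (intro deriv_bound)
  \<comment> \<open>Product rule: differentiating the factor \<open>i\<close> leaves its slope
    \<open>y i / 2\<close>, and the other factors are evaluated at t = 0. The order of summation is
    then exchanged.\<close>
  moreover have "poly (pderiv p) 0 = (\<Sum>S\<in>Pow V. \<Sum>i\<in>S. a S * (\<Prod>j\<in>S - {i}. x j / 2) * (y i / 2))"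
    unfolding p_def
    by (simp add: higher_pderiv_sum[of 1, simplified] pderiv_smult pderiv_prod pderiv_pCons poly_sum poly_prod sum_distrib_left mult_ac)
  also have "\<dots> = (\<Sum>S\<in>Pow V. \<Sum>i\<in>V. if i \<in> S then a S * (\<Prod>j\<in>S - {i}. x j / 2) * (y i / 2) else 0)"
    using V by (intro sum.cong refl sum.mono_neutral_cong_left) auto
  also have "\<dots> = (\<Sum>i\<in>V. \<Sum>S\<in>Pow V. if i \<in> S then a S * (\<Prod>j\<in>S - {i}. x j / 2) * (y i / 2) else 0)"
    by (rule sum.swap)
  also have "\<dots> = (\<Sum>i\<in>V. \<Sum>S | S \<subseteq> V \<and> i \<in> S. a S * (\<Prod>j\<in>S - {i}. x j / 2) * (y i / 2))"
    using V by (intro sum.cong refl sum.mono_neutral_cong_right) auto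
  also have "\<dots> = (\<Sum>i\<in>V. D i * (y i / 2))"
    using V by (intro sum.cong refl) (simp add: D_def multiaffine_halved_partial sum_distrib_right sum_divide_distrib)
  also have "\<dots> = (\<Sum>i\<in>V. \<bar>D i\<bar>) / 2"
    unfolding sum_divide_distrib by (intro sum.cong refl) (auto simp: y_def)
  ultimately show ?thesis
    by (simp add: D_def)
qed

text \<open>For each variable, undoing the halving costs 2^(k - 1) and passing from L2 to L1 costs
  3^(k - 1), as a partial derivative has degree at most k - 1. Averaging
  \<open>sum_partials_bound\<close> over the vertices supplies 2 * 3^(k - 1) * B.\<close>

lemma sum_influence_bound:
  assumes V: "finite V" and k: "k \<ge> 1" and deg: "\<And>S. S \<subseteq> V \<Longrightarrow> a S \<noteq> 0 \<Longrightarrow> card S \<le> k"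
    and B: "\<And>X. X \<subseteq> V \<Longrightarrow> \<bar>multiaffine a V (vertex X)\<bar> \<le> B"
  shows "(\<Sum>i\<in>V. influence a V i) \<le> 2 * 18 ^ (k - 1) * B"
proof -
  have "influence a V i \<le> 6 ^ (k - 1) * cube_mean V (\<lambda>X. \<bar>multiaffine (halved_partial a i) V (vertex X)\<bar>)"
    if i: "i \<in> V" for i
  proof -
    let ?b = "halved_partial a i"
    have degb: "card S \<le> k - 1" if "S \<subseteq> V" "?b S \<noteq> 0" for S
      using that i deg[of "insert i S"] finite_subset[OF _ V, of S]
      by (auto simp: halved_partial_def split: if_splits)
    have "(\<Sum>T | T \<subseteq> V \<and> i \<in> T. (a T)\<^sup>2) \<le>
      (\<Sum>T | T \<subseteq> V \<and> i \<in> T. 4 ^ (k - 1) * (a T * (1 / 2) ^ card (T - {i}))\<^sup>2)"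
    proof (rule sum_mono)
      fix T assume T: "T \<in> {T. T \<subseteq> V \<and> i \<in> T}"
      show "(a T)\<^sup>2 \<le> 4 ^ (k - 1) * (a T * (1 / 2) ^ card (T - {i}))\<^sup>2"
      proof (cases "a T = 0")
        case False
        then have "card (T - {i}) \<le> k - 1"
          using deg[of T] T finite_subset[OF _ V, of T] by (auto simp: card_Diff_singleton)
        then have "(4 :: real) ^ card (T - {i}) \<le> 4 ^ (k - 1)"
          by (intro power_increasing) auto
        moreover have "((1 / 2 :: real) ^ card (T - {i}))\<^sup>2 = 1 / 4 ^ card (T - {i})"
          by (simp add: power_divide power2_eq_square flip: power_mult_distrib)
        ultimately have "1 \<le> 4 ^ (k - 1) * ((1 / 2 :: real) ^ card (T - {i}))\<^sup>2"
          by (simp add: field_simps)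
        from mult_left_mono[OF this, of "(a T)\<^sup>2"] show ?thesis
          by (simp add: power_mult_distrib mult_ac)
      qed simp
    qed
    also have "\<dots> = 4 ^ (k - 1) * (\<Sum>S\<in>Pow V. (?b S)\<^sup>2)"
      unfolding sum_distrib_left[symmetric]
      by (subst sum_halved_partial[OF V i, of "\<lambda>_ t. t\<^sup>2"]) auto
    finally have "influence a V i \<le> sqrt (4 ^ (k - 1) * (\<Sum>S\<in>Pow V. (?b S)\<^sup>2))"
      by (simp add: influence_def)
    also have "\<dots> = 2 ^ (k - 1) * sqrt (\<Sum>S\<in>Pow V. (?b S)\<^sup>2)"
      by (simp add: real_sqrt_mult real_sqrt_power)
    also have "\<dots> \<le> 2 ^ (k - 1) * (3 ^ (k - 1) * cube_mean V (\<lambda>X. \<bar>multiaffine ?b V (vertex X)\<bar>))"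
      using degb V by (intro mult_left_mono multiaffine_l2_le_l1) auto
    finally show ?thesis
      using power_mult_distrib[of "2 :: real" 3 "k - 1"] by simp
  qed
  then have "(\<Sum>i\<in>V. influence a V i) \<le>
      6 ^ (k - 1) * cube_mean V (\<lambda>X. \<Sum>i\<in>V. \<bar>multiaffine (halved_partial a i) V (vertex X)\<bar>)"
    unfolding cube_mean_sum sum_distrib_left by (intro sum_mono)
  also have "\<dots> \<le> 6 ^ (k - 1) * cube_mean V (\<lambda>X. 2 * 3 ^ (k - 1) * B)"
    using V k deg multiaffine_bounded[OF V B]
    by (intro mult_left_mono cube_mean_mono sum_partials_bound) (auto simp: vertex_def)
  also have "\<dots> = 2 * 18 ^ (k - 1) * B"
    using V power_mult_distrib[of "6 :: real" 3 "k - 1"] by (simp add: cube_mean_const)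
  finally show ?thesis .
qed

section \<open>From influences to the sum of powers of the coefficients\<close>

lemma sum_Pow_prod_le_exp:
  fixes w :: "'v \<Rightarrow> real"
  assumes "finite V" "\<And>i. i \<in> V \<Longrightarrow> 0 \<le> w i"
  shows "(\<Sum>S\<in>Pow V. \<Prod>i\<in>S. w i) \<le> exp (\<Sum>i\<in>V. w i)"
proof -
  have "(\<Sum>S\<in>Pow V. \<Prod>i\<in>S. w i) = (\<Prod>i\<in>V. w i + 1)"
    using assms(1) by (simp add: prod_add)
  also have "\<dots> \<le> (\<Prod>i\<in>V. exp (w i))"
    using assms(2) exp_ge_add_one_self by (intro prod_mono) (auto simp: add.commute)
  finally show ?thesis
    using assms(1) by (simp add: exp_sum)
qed

text \<open>The two terms on the right agree at t^2 = m^(k + 1). Below this threshold m^k alone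
  suffices, above it t^2 / m does.\<close>

lemma powr_le_split:
  fixes m t :: real
  assumes "0 < m" "k \<ge> 1"
  shows "\<bar>t\<bar> powr (2 * real k / (real k + 1)) \<le> t\<^sup>2 / m + m ^ k"
proof (cases "t = 0")
  case False
  let ?q = "1 / (real k + 1)"
  have t2: "t\<^sup>2 = \<bar>t\<bar> powr 2"
    using False by (simp add: powr_numeral)
  have mk: "(m ^ (k + 1)) powr (real k * ?q) = m ^ k" "(m ^ (k + 1)) powr (- ?q) = 1 / m"
  proof -
    have "m ^ (k + 1) = m powr (real k + 1)"
      using assms powr_realpow[of m "k + 1"] by (simp add: add.commute)
    then have "(m ^ (k + 1)) powr r = m powr ((real k + 1) * r)" for r
      by (simp only: powr_powr)
    then show "(m ^ (k + 1)) powr (real k * ?q) = m ^ k" "(m ^ (k + 1)) powr (- ?q) = 1 / m"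
      using assms by (simp_all add: powr_realpow powr_minus_divide)
  qed
  show ?thesis
  proof (cases "t\<^sup>2 \<le> m ^ (k + 1)")
    case True
    have "\<bar>t\<bar> powr (2 * real k / (real k + 1)) = (t\<^sup>2) powr (real k * ?q)"
      unfolding t2 powr_powr by simp
    also have "\<dots> \<le> (m ^ (k + 1)) powr (real k * ?q)"
      using True by (intro powr_mono2) auto
    finally show ?thesis
      unfolding mk using assms by (simp add: add_increasing)
  next
    case False
    have "\<bar>t\<bar> powr (2 * real k / (real k + 1)) = (t\<^sup>2) powr (1 + - ?q)"
      unfolding t2 powr_powr by (intro arg_cong2[of _ _ _ _ "(powr)"] refl) (simp add: field_simps)
    also have "\<dots> = t\<^sup>2 * (t\<^sup>2) powr (- ?q)"
      using \<open>t \<noteq> 0\<close> by (subst powr_add) auto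
    also have "\<dots> \<le> t\<^sup>2 * (m ^ (k + 1)) powr (- ?q)"
      using False assms by (intro mult_left_mono powr_mono2') auto
    finally show ?thesis
      unfolding mk using assms by (simp add: add_increasing2)
  qed
qed (use assms in auto)

text \<open>Replacing the minimal influence by all of them makes both terms summable: double
  counting turns the first into the sum of the influences, and the second is at most exp 1. The
  total is at most 1 + 3.\<close>

lemma sum_powr_bound_normalized:
  assumes V: "finite V" and k: "k \<ge> 1" and deg: "\<And>S. S \<subseteq> V \<Longrightarrow> a S \<noteq> 0 \<Longrightarrow> card S \<le> k"
    and a0: "\<bar>a {}\<bar> \<le> 1" and infl: "(\<Sum>i\<in>V. influence a V i) \<le> 1"
  shows "(\<Sum>S\<in>Pow V. \<bar>a S\<bar> powr (2 * real k / (real k + 1))) \<le> 4"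
proof -
  let ?p = "2 * real k / (real k + 1)" and ?L = "influence a V"
  have Lnn: "0 \<le> ?L i" for i
    by (simp add: influence_def sum_nonneg)
  have L1: "?L i \<le> 1" if "i \<in> V" for i
    using member_le_sum[of i V ?L] that V Lnn infl by auto
  have le_L: "\<bar>a S\<bar> \<le> ?L i" if "S \<subseteq> V" "i \<in> S" for S i
    unfolding influence_def
    by (rule real_le_rsqrt, simp, rule member_le_sum[of S _ "\<lambda>T. (a T)\<^sup>2"]) (use that V in auto)
  have bound: "\<bar>a S\<bar> powr ?p \<le> (\<Sum>i\<in>S. (a S)\<^sup>2 / ?L i) + (\<Prod>i\<in>S. ?L i)" if S: "S \<in> Pow V" for S
  proof -
    have fin: "finite S" using S V finite_subset by auto
    consider "a S = 0" | "S = {}" | "a S \<noteq> 0" "S \<noteq> {}" by blast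
    then show ?thesis
    proof cases
      case 1
      then show ?thesis by (simp add: prod_nonneg Lnn)
    next
      \<comment> \<open>The empty product is 1, which pays for the constant coefficient.\<close>
      case 2
      then show ?thesis using powr_mono2[of ?p "\<bar>a {}\<bar>" 1] a0 by simp
    next
      case 3
      define m where "m = Min (?L ` S)"
      have "m \<in> ?L ` S"
        unfolding m_def using fin 3 by (intro Min_in) auto
      then obtain j where j: "j \<in> S" "m = ?L j" by auto
      have m0: "0 < m"
        using le_L[of S j] 3 S j by auto
      \<comment> \<open>Here m \<le> 1 and \<open>card S\<close> \<le> k, so lowering the exponent
        can only enlarge the power.\<close>
      have "m ^ k \<le> m ^ card S"
        using deg[of S] 3 S m0 j L1[of j] by (intro power_decreasing) auto
      also have "\<dots> = (\<Prod>i\<in>S. m)"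
        by simp
      also have "\<dots> \<le> (\<Prod>i\<in>S. ?L i)"
        using fin m0 by (intro prod_mono) (auto simp: m_def)
      finally have "m ^ k \<le> (\<Prod>i\<in>S. ?L i)" .
      moreover have "(a S)\<^sup>2 / m \<le> (\<Sum>i\<in>S. (a S)\<^sup>2 / ?L i)"
        unfolding j(2) using fin j(1) Lnn by (intro member_le_sum) auto
      ultimately show ?thesis
        using powr_le_split[OF m0 k, of "a S"] by linarith
    qed
  qed
  have "(\<Sum>S\<in>Pow V. \<Sum>i\<in>S. (a S)\<^sup>2 / ?L i) = (\<Sum>S\<in>Pow V. \<Sum>i\<in>V. if i \<in> S then (a S)\<^sup>2 / ?L i else 0)"
    using V by (intro sum.cong refl sum.mono_neutral_cong_left) auto
  also have "\<dots> = (\<Sum>i\<in>V. \<Sum>S\<in>Pow V. if i \<in> S then (a S)\<^sup>2 / ?L i else 0)"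
    by (rule sum.swap)
  also have "\<dots> = (\<Sum>i\<in>V. \<Sum>S | S \<subseteq> V \<and> i \<in> S. (a S)\<^sup>2 / ?L i)"
    using V by (intro sum.cong refl sum.mono_neutral_cong_right) auto
  \<comment> \<open>The inner sum of squares is the square of \<open>?L i\<close>; a vanishing
    influence is harmless since 0 / 0 = 0.\<close>
  also have "\<dots> = (\<Sum>i\<in>V. ?L i)"
    unfolding sum_divide_distrib[symmetric] influence_def
    by (intro sum.cong refl) (simp add: sum_nonneg real_div_sqrt)
  finally have "(\<Sum>S\<in>Pow V. \<Sum>i\<in>S. (a S)\<^sup>2 / ?L i) = (\<Sum>i\<in>V. ?L i)" .
  moreover have "(\<Sum>S\<in>Pow V. \<Prod>i\<in>S. ?L i) \<le> exp 1"
    using sum_Pow_prod_le_exp[OF V, of ?L] Lnn infl by (meson exp_le_cancel_iff order_trans)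
  moreover have "(\<Sum>S\<in>Pow V. \<bar>a S\<bar> powr ?p) \<le>
      (\<Sum>S\<in>Pow V. \<Sum>i\<in>S. (a S)\<^sup>2 / ?L i) + (\<Sum>S\<in>Pow V. \<Prod>i\<in>S. ?L i)"
    unfolding sum.distrib[symmetric] by (intro sum_mono bound)
  ultimately show ?thesis
    using infl exp_le by linarith
qed

lemma sum_powr_bound:
  assumes V: "finite V" and k: "k \<ge> 1" and deg: "\<And>S. S \<subseteq> V \<Longrightarrow> a S \<noteq> 0 \<Longrightarrow> card S \<le> k"
    and A: "0 < A" and a0: "\<bar>a {}\<bar> \<le> A" and infl: "(\<Sum>i\<in>V. influence a V i) \<le> A"
  shows "(\<Sum>S\<in>Pow V. \<bar>a S\<bar> powr (2 * real k / (real k + 1))) \<le> 4 * A powr (2 * real k / (real k + 1))"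
proof -
  let ?p = "2 * real k / (real k + 1)" and ?b = "\<lambda>S. a S / A"
  have "influence ?b V i = influence a V i / A" for i
    using A by (simp add: influence_def power_divide real_sqrt_divide flip: sum_divide_distrib)
  then have le4: "(\<Sum>S\<in>Pow V. \<bar>?b S\<bar> powr ?p) \<le> 4"
    using A a0 infl deg by (intro sum_powr_bound_normalized[OF V k]) (auto simp flip: sum_divide_distrib)
  have "\<bar>a S\<bar> powr ?p = \<bar>?b S\<bar> powr ?p * A powr ?p" for S
    using A by (simp flip: powr_mult)
  then have "(\<Sum>S\<in>Pow V. \<bar>a S\<bar> powr ?p) = (\<Sum>S\<in>Pow V. \<bar>?b S\<bar> powr ?p) * A powr ?p"
    by (simp only: sum_distrib_right)
  also have "\<dots> \<le> 4 * A powr ?p"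
    by (rule mult_right_mono[OF le4 powr_ge_zero])
  finally show ?thesis .
qed

subsection \<open>Product states\<close>

text \<open>The state with amplitudes r and x + iy has Bloch vector (2rx, 2ry, r^2 - x^2 - y^2).
  Given a unit vector (u, v, w), this is solved with r^2 = (1 + w) / 2.\<close>

lemma bloch_vector_exists:
  fixes s :: "pauli \<Rightarrow> real"
  assumes "\<And>p. \<bar>s p\<bar> = 1"
  shows "\<exists>\<phi> :: bool \<Rightarrow> complex. \<forall>p.
    (\<Sum>a\<in>UNIV. \<Sum>b\<in>UNIV. cnj (\<phi> a) * pauli_matrix p $ a $ b * \<phi> b) =
      of_real (if p = PI then 1 else s p / sqrt 3)"
proof -
  define u v w where "u = s PX / sqrt 3" and "v = s PY / sqrt 3" and "w = s PZ / sqrt 3"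
  have sq: "(s p / sqrt 3)\<^sup>2 = 1 / 3" for p
    using assms[of p] by (simp add: power_divide abs_square_eq_1)
  have sph: "u\<^sup>2 + v\<^sup>2 + w\<^sup>2 = 1"
    unfolding u_def v_def w_def sq by simp
  \<comment> \<open>Keeps r positive, so that x and y can be defined by division.\<close>
  have "w\<^sup>2 < 1"
    using sq[of PZ] by (simp add: w_def)
  then have "0 < 1 + w"
    by (simp add: abs_square_less_1)
  define r where "r = sqrt ((1 + w) / 2)"
  have r: "0 < r" "r * r = (1 + w) / 2"
    using \<open>0 < 1 + w\<close> by (simp_all add: r_def)
  define x y where "x = u / (2 * r)" and "y = v / (2 * r)"
  have rx: "2 * (r * x) = u" and ry: "2 * (r * y) = v"
    using r by (simp_all add: x_def y_def)
  have "4 * (r * r) * (x * x + y * y) = u * u + v * v"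
    unfolding rx[symmetric] ry[symmetric] by (simp add: algebra_simps)
  also have "\<dots> = 4 * (r * r) * ((1 - w) / 2)"
  proof -
    have "4 * (r * r) * ((1 - w) / 2) = (1 + w) * (1 - w)"
      by (simp add: r(2))
    also have "\<dots> = u * u + v * v"
      using sph by (simp add: power2_eq_square algebra_simps)
    finally show ?thesis ..
  qed
  finally have "x * x + y * y = (1 - w) / 2"
    using r(1) by simp
  then have rr: "r * r + (x * x + y * y) = 1" "r * r - (x * x + y * y) = w"
    unfolding r(2) by (simp_all add: field_simps)
  define \<phi> where "\<phi> b = (if b then Complex x y else of_real r)" for b
  have "(\<Sum>a\<in>UNIV. \<Sum>b\<in>UNIV. cnj (\<phi> a) * pauli_matrix p $ a $ b * \<phi> b) =
      of_real (if p = PI then 1 else s p / sqrt 3)" for p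
    by (cases p)
       (simp_all add: UNIV_bool mat_def \<phi>_def complex_eq_iff rx ry rr flip: u_def v_def w_def)
  then show ?thesis by blast
qed

definition quadratic_form :: "complex ^ ('n::finite \<Rightarrow> bool) \<Rightarrow> 'n operator \<Rightarrow> complex" where
  "quadratic_form \<psi> M = (\<Sum>x\<in>UNIV. \<Sum>y\<in>UNIV. cnj (\<psi> $ x) * M $ x $ y * \<psi> $ y)"

lemma quadratic_form_add: "quadratic_form \<psi> (A + B) = quadratic_form \<psi> A + quadratic_form \<psi> B"
  by (simp add: quadratic_form_def distrib_left distrib_right sum.distrib)

lemma quadratic_form_scaleR: "quadratic_form \<psi> (c *\<^sub>R A) = of_real c * quadratic_form \<psi> A"
  unfolding quadratic_form_def sum_distrib_left
  by (intro sum.cong refl) (simp add: scaleR_conv_of_real [where 'a = complex])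

lemma quadratic_form_sum:
  "quadratic_form \<psi> (\<Sum>P\<in>I. \<alpha> P *\<^sub>R M P) = (\<Sum>P\<in>I. of_real (\<alpha> P) * quadratic_form \<psi> (M P))"
proof (induction I rule: infinite_finite_induct)
  case (insert P I)
  then show ?case
    by (simp add: quadratic_form_add quadratic_form_scaleR)
qed (simp_all add: quadratic_form_def)

text \<open>The inner product on complex vectors is the real one, hence the real part.\<close>

lemma inner_quadratic_form: "\<psi> \<bullet> (M *v \<psi>) = Re (quadratic_form \<psi> M)"
proof -
  have "\<psi> \<bullet> (M *v \<psi>) = (\<Sum>x\<in>UNIV. Re (cnj (\<psi> $ x) * (\<Sum>y\<in>UNIV. M $ x $ y * \<psi> $ y)))"
    by (simp add: inner_vec_def matrix_vector_mult_def inner_complex_def)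
  also have "\<dots> = Re (quadratic_form \<psi> M)"
    by (simp only: quadratic_form_def Re_sum sum_distrib_left mult.assoc)
  finally show ?thesis .
qed

lemma quadratic_form_le_spectral_norm:
  "\<bar>Re (quadratic_form \<psi> M)\<bar> \<le> spectral_norm M * (norm \<psi>)\<^sup>2"
proof -
  have "\<bar>\<psi> \<bullet> (M *v \<psi>)\<bar> \<le> norm \<psi> * norm (M *v \<psi>)"
    by (rule Cauchy_Schwarz_ineq2)
  also have "\<dots> \<le> norm \<psi> * (spectral_norm M * norm \<psi>)"
    unfolding spectral_norm_def by (intro mult_left_mono onorm) auto
  finally show ?thesis
    by (simp add: inner_quadratic_form power2_eq_square mult_ac)
qed

text \<open>Distributivity factors the sums over bit strings into one factor per qubit, first for
  columns and then for rows.\<close>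

lemma quadratic_form_product:
  fixes \<phi> :: "'n::finite \<Rightarrow> bool \<Rightarrow> complex"
  shows "quadratic_form (\<chi> z. \<Prod>i\<in>UNIV. \<phi> i (z i)) (pauli_op P) =
    (\<Prod>i\<in>UNIV. \<Sum>a\<in>UNIV. \<Sum>b\<in>UNIV. cnj (\<phi> i a) * pauli_matrix (P i) $ a $ b * \<phi> i b)"
proof -
  have "quadratic_form (\<chi> z. \<Prod>i\<in>UNIV. \<phi> i (z i)) (pauli_op P) =
      (\<Sum>x\<in>UNIV. \<Sum>y\<in>UNIV. \<Prod>i\<in>UNIV. cnj (\<phi> i (x i)) * pauli_matrix (P i) $ x i $ y i * \<phi> i (y i))"
    by (simp add: quadratic_form_def pauli_op_def prod.distrib cnj_prod)
  also have "\<dots> = (\<Sum>x\<in>UNIV. \<Prod>i\<in>UNIV. \<Sum>b\<in>UNIV.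
        cnj (\<phi> i (x i)) * pauli_matrix (P i) $ x i $ b * \<phi> i b)"
    by (subst prod_sum_PiE) (simp_all add: PiE_UNIV_domain)
  also have "\<dots> = (\<Prod>i\<in>UNIV. \<Sum>a\<in>UNIV. \<Sum>b\<in>UNIV.
        cnj (\<phi> i a) * pauli_matrix (P i) $ a $ b * \<phi> i b)"
    by (subst prod_sum_PiE) (simp_all add: PiE_UNIV_domain)
  finally show ?thesis .
qed

lemma pauli_op_identity: "pauli_op (\<lambda>_ :: 'n::finite. PI) = mat 1"
proof -
  have "(\<Prod>i\<in>UNIV. if x i = y i then 1 else 0) = (if x = y then 1 else 0 :: complex)" for x y :: "'n \<Rightarrow> bool"
    by (cases "x = y") (auto simp: fun_eq_iff)
  then show ?thesis
    by (simp add: pauli_op_def mat_def)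
qed

lemma product_state_bound:
  fixes \<alpha> :: "('n::finite \<Rightarrow> pauli) \<Rightarrow> real" and x :: "'n \<times> pauli \<Rightarrow> real"
  assumes "\<And>j. \<bar>x j\<bar> = 1"
  shows "\<bar>\<Sum>P\<in>UNIV. \<alpha> P * (\<Prod>i\<in>UNIV. if P i = PI then 1 else x (i, P i) / sqrt 3)\<bar> \<le>
    spectral_norm (\<Sum>P\<in>UNIV. \<alpha> P *\<^sub>R pauli_op P)"
proof -
  have "\<forall>i. \<exists>\<phi> :: bool \<Rightarrow> complex. \<forall>p.
      (\<Sum>a\<in>UNIV. \<Sum>b\<in>UNIV. cnj (\<phi> a) * pauli_matrix p $ a $ b * \<phi> b) =
        of_real (if p = PI then 1 else x (i, p) / sqrt 3)"
    by (intro allI bloch_vector_exists assms)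
  from choice[OF this] obtain \<phi> :: "'n \<Rightarrow> bool \<Rightarrow> complex" where "\<forall>i p.
      (\<Sum>a\<in>UNIV. \<Sum>b\<in>UNIV. cnj (\<phi> i a) * pauli_matrix p $ a $ b * \<phi> i b) =
        of_real (if p = PI then 1 else x (i, p) / sqrt 3)" ..
  then have \<phi>: "(\<Sum>a\<in>UNIV. \<Sum>b\<in>UNIV. cnj (\<phi> i a) * pauli_matrix p $ a $ b * \<phi> i b) =
        of_real (if p = PI then 1 else x (i, p) / sqrt 3)" for i p
    by blast
  define \<psi> :: "complex ^ ('n \<Rightarrow> bool)" where "\<psi> = (\<chi> z. \<Prod>i\<in>UNIV. \<phi> i (z i))"
  have qf: "quadratic_form \<psi> (pauli_op P) =
      of_real (\<Prod>i\<in>UNIV. if P i = PI then 1 else x (i, P i) / sqrt 3)" for P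
    unfolding \<psi>_def quadratic_form_product \<phi> of_real_prod ..
  \<comment> \<open>The product state is normalised because its squared norm is the expectation of
    the identity string.\<close>
  have "(norm \<psi>)\<^sup>2 = \<psi> \<bullet> (pauli_op (\<lambda>_. PI) *v \<psi>)"
    by (simp add: pauli_op_identity power2_norm_eq_inner)
  also have "\<dots> = 1"
    unfolding inner_quadratic_form qf by simp
  finally show ?thesis
    using quadratic_form_le_spectral_norm[of \<psi> "\<Sum>P\<in>UNIV. \<alpha> P *\<^sub>R pauli_op P"]
    unfolding quadratic_form_sum qf of_real_mult[symmetric] of_real_sum[symmetric] Re_complex_of_real
    by simp
qed

section \<open>Pauli strings as monomials in the coordinates (qubit, letter)\<close>

definition pauli_support :: "('n \<Rightarrow> pauli) \<Rightarrow> ('n \<times> pauli) set" where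
  "pauli_support P = (\<lambda>i. (i, P i)) ` {i. P i \<noteq> PI}"

lemma inj_pauli_support: "inj pauli_support"
proof (rule injI, rule ext)
  fix P Q :: "'n \<Rightarrow> pauli" and i
  assume "pauli_support P = pauli_support Q"
  moreover have "(i, p) \<in> pauli_support R \<longleftrightarrow> p = R i \<and> p \<noteq> PI" for p and R :: "'n \<Rightarrow> pauli"
    by (auto simp: pauli_support_def)
  ultimately show "P i = Q i"
    by metis
qed

lemma card_pauli_support: "card (pauli_support P) = pauli_weight P"
  unfolding pauli_support_def pauli_weight_def by (intro card_image inj_onI) simp

lemma prod_pauli_support:
  fixes x :: "'n::finite \<times> pauli \<Rightarrow> real"
  shows "(\<Prod>i\<in>UNIV. if P i = PI then 1 else x (i, P i) / c) =
    (\<Prod>j\<in>pauli_support P. x j) / c ^ pauli_weight P"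
proof -
  have "(\<Prod>i\<in>UNIV. if P i = PI then 1 else x (i, P i) / c) = (\<Prod>i | P i \<noteq> PI. x (i, P i) / c)"
    by (intro prod.mono_neutral_cong_right) auto
  also have "\<dots> = (\<Prod>j\<in>pauli_support P. x j) / c ^ pauli_weight P"
    unfolding pauli_support_def pauli_weight_def prod_dividef prod_constant
    by (subst prod.reindex) (auto simp: inj_on_def)
  finally show ?thesis .
qed

lemma pauli_norm_bound:
  fixes H :: "'n::finite operator"
  assumes k: "k \<ge> 1" and H: "local_hamiltonian k H"
  shows "pauli_norm (2 * real k / (real k + 1)) H \<le> 8 * 18 ^ (k - 1) * sqrt 3 ^ k * spectral_norm H"
proof -
  let ?p = "2 * real k / (real k + 1)"
  have p: "1 \<le> ?p" using k by simp
  obtain \<beta> where \<beta>: "H = (\<Sum>P | pauli_weight P \<le> k. \<beta> P *\<^sub>R pauli_op P)"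
    using H unfolding local_hamiltonian_def by blast
  \<comment> \<open>Extension by zero, so that \<open>pauli_coeff_sum\<close> identifies the
    coefficients of H.\<close>
  define \<alpha> where "\<alpha> P = (if pauli_weight P \<le> k then \<beta> P else 0)" for P
  have H_eq: "H = (\<Sum>P\<in>UNIV. \<alpha> P *\<^sub>R pauli_op P)"
    unfolding \<beta> \<alpha>_def by (intro sum.mono_neutral_cong_left) auto
  define V :: "('n \<times> pauli) set" where "V = UNIV"
  have V: "finite V" by (simp add: V_def)
  \<comment> \<open>By injectivity each fibre has at most one string; the sum also gives 0 for sets
    that encode no string.\<close>
  define a where "a S = (\<Sum>P | pauli_support P = S. \<alpha> P / sqrt 3 ^ pauli_weight P)" for S
  have a_supp: "a (pauli_support P) = \<alpha> P / sqrt 3 ^ pauli_weight P" for P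
  proof -
    have "{Q. pauli_support Q = pauli_support P} = {P}"
      using inj_pauli_support by (auto simp: inj_def)
    then show ?thesis by (simp add: a_def)
  qed
  have deg: "card S \<le> k" if "a S \<noteq> 0" for S
  proof -
    have "\<exists>P. pauli_support P = S \<and> \<alpha> P \<noteq> 0"
    proof (rule ccontr)
      assume "\<nexists>P. pauli_support P = S \<and> \<alpha> P \<noteq> 0"
      then have "a S = 0"
        unfolding a_def by (intro sum.neutral) auto
      with that show False by simp
    qed
    then obtain P where "pauli_support P = S" "\<alpha> P \<noteq> 0"
      by blast
    then show ?thesis
      by (auto simp: \<alpha>_def card_pauli_support split: if_splits)
  qed
  have f: "multiaffine a V x = (\<Sum>P\<in>UNIV. \<alpha> P * (\<Prod>i\<in>UNIV. if P i = PI then 1 else x (i, P i) / sqrt 3))" for x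
  proof -
    have "multiaffine a V x = (\<Sum>S\<in>Pow V. \<Sum>P | P \<in> UNIV \<and> pauli_support P = S.
        \<alpha> P * (\<Prod>i\<in>UNIV. if P i = PI then 1 else x (i, P i) / sqrt 3))"
      unfolding multiaffine_def a_def sum_distrib_right prod_pauli_support
      by (intro sum.cong refl) auto
    also have "\<dots> = (\<Sum>P\<in>UNIV. \<alpha> P * (\<Prod>i\<in>UNIV. if P i = PI then 1 else x (i, P i) / sqrt 3))"
      by (rule sum.group) (auto simp: V_def)
    finally show ?thesis .
  qed
  have f_vertex: "\<bar>multiaffine a V (vertex X)\<bar> \<le> spectral_norm H" for X
    unfolding f H_eq by (rule product_state_bound) (auto simp: vertex_def)
  \<comment> \<open>The constant coefficient is the value at the centre of the cube.\<close>
  have "multiaffine a V (\<lambda>_. 0) = (\<Sum>S\<in>{{}}. a S * (\<Prod>i\<in>S. 0))"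
    unfolding multiaffine_def using finite_subset[OF _ V]
    by (intro sum.mono_neutral_right) (auto simp: V_def)
  then have a0: "\<bar>a {}\<bar> \<le> spectral_norm H"
    using multiaffine_bounded[OF V f_vertex, of "\<lambda>_. 0"] by simp
  have infl: "(\<Sum>i\<in>V. influence a V i) \<le> 2 * 18 ^ (k - 1) * spectral_norm H"
    using deg f_vertex by (intro sum_influence_bound V k)
  have norm_eq: "pauli_norm ?p H = (\<Sum>P\<in>UNIV. \<bar>\<alpha> P\<bar> powr ?p) powr (1 / ?p)"
    unfolding pauli_norm_def H_eq pauli_coeff_sum ..
  have sn: "0 \<le> spectral_norm H"
    using a0 by linarith
  \<comment> \<open>The spectral norm may be 0 while \<open>sum_powr_bound\<close> divides by A, so
    the bound is shown for every strictly larger A and \<open>dense_ge\<close> passes to the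
    limit.\<close>
  have "pauli_norm ?p H \<le> 4 * sqrt 3 ^ k * A" if A: "2 * 18 ^ (k - 1) * spectral_norm H < A" for A
  proof -
    have "1 * spectral_norm H \<le> 2 * 18 ^ (k - 1) * spectral_norm H"
    proof (intro mult_right_mono sn)
      show "(1 :: real) \<le> 2 * 18 ^ (k - 1)"
        using one_le_power[of "18 :: real" "k - 1"] by linarith
    qed
    then have A': "0 < A" "\<bar>a {}\<bar> \<le> A"
      using A sn a0 by linarith+
    have "(\<Sum>P\<in>UNIV. \<bar>\<alpha> P\<bar> powr ?p) \<le> (\<Sum>P\<in>UNIV. (sqrt 3 ^ k) powr ?p * \<bar>a (pauli_support P)\<bar> powr ?p)"
    proof (rule sum_mono)
      fix P
      have "\<bar>\<alpha> P\<bar> = sqrt 3 ^ pauli_weight P * \<bar>a (pauli_support P)\<bar>"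
        by (simp add: a_supp)
      \<comment> \<open>Strings of weight above k have coefficient 0; for the others the weight is
        at most k.\<close>
      also have "\<dots> \<le> sqrt 3 ^ k * \<bar>a (pauli_support P)\<bar>"
      proof (cases "pauli_weight P \<le> k")
        case True
        then show ?thesis
          by (intro mult_right_mono power_increasing) auto
      qed (simp add: a_supp \<alpha>_def)
      finally have "\<bar>\<alpha> P\<bar> powr ?p \<le> (sqrt 3 ^ k * \<bar>a (pauli_support P)\<bar>) powr ?p"
        by (intro powr_mono2) auto
      then show "\<bar>\<alpha> P\<bar> powr ?p \<le> (sqrt 3 ^ k) powr ?p * \<bar>a (pauli_support P)\<bar> powr ?p"
        by (simp add: powr_mult)
    qed
    also have "\<dots> = (sqrt 3 ^ k) powr ?p * (\<Sum>S\<in>range pauli_support. \<bar>a S\<bar> powr ?p)"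
      by (simp add: sum_distrib_left sum.reindex inj_pauli_support)
    also have "\<dots> \<le> (sqrt 3 ^ k) powr ?p * (\<Sum>S\<in>Pow V. \<bar>a S\<bar> powr ?p)"
      by (intro mult_left_mono sum_mono2) (auto simp: V_def)
    also have "\<dots> \<le> (sqrt 3 ^ k) powr ?p * (4 * A powr ?p)"
      using infl A A' deg by (intro mult_left_mono sum_powr_bound V k) auto
    finally have "pauli_norm ?p H \<le> ((sqrt 3 ^ k) powr ?p * (4 * A powr ?p)) powr (1 / ?p)"
      unfolding norm_eq by (intro powr_mono2) (auto intro: sum_nonneg)
    also have "\<dots> = (sqrt 3 ^ k * A) * 4 powr (1 / ?p)"
      using A' k by (simp add: powr_mult powr_powr)
    also have "\<dots> \<le> (sqrt 3 ^ k * A) * 4 powr 1"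
      using A' p k by (intro mult_left_mono powr_mono) auto
    finally show ?thesis by (simp add: mult_ac)
  qed
  then have "pauli_norm ?p H / (4 * sqrt 3 ^ k) \<le> A" if "2 * 18 ^ (k - 1) * spectral_norm H < A" for A
    using that by (simp add: divide_le_eq mult_ac)
  then have "pauli_norm ?p H / (4 * sqrt 3 ^ k) \<le> 2 * 18 ^ (k - 1) * spectral_norm H"
    by (rule dense_ge)
  then show ?thesis
    by (simp add: divide_le_eq mult_ac)
qed

subsection \<open>The constant\<close>

text \<open>The squared form of the comparison of constants, with 23/2 as a rational lower bound for
  (sqrt 2 + 2)^2. The induction step uses (k / (k + 1))^(k + 1) \<le> 1/e \<le> 10/27 and 4 k^2
  \<le> (k + 1)^3: the factor is 324 / 4 * (10/27)^2 = 100/9 < 23/2.\<close>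

lemma factorial_growth_bound:
  fixes k :: nat
  assumes "k \<ge> 1"
  shows "128 * 324 ^ (k - 1) * fact k \<le> 36 * real k ^ (2 * k + 4) * (23 / 2) ^ k"
  using assms
proof (induction k rule: dec_induct)
  case base
  then show ?case by simp
next
  case (step k)
  have k: "real k > 0" using step by simp
  have "exp (- (1 / (real k + 1))) \<ge> 1 - 1 / (real k + 1)"
    using exp_ge_add_one_self[of "- (1 / (real k + 1))"] by simp
  then have "(1 - 1 / (real k + 1)) ^ (k + 1) \<le> exp (- (1 / (real k + 1))) ^ (k + 1)"
    by (intro power_mono) (auto simp: field_simps)
  also have "\<dots> = exp (- 1)"
    by (subst exp_of_nat_mult[symmetric]) (simp add: field_simps)
  also have "1 - 1 / (real k + 1) = real k / (real k + 1)"
    by (simp add: field_simps)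
  finally have "real k ^ (k + 1) \<le> exp (- 1) * (real k + 1) ^ (k + 1)"
    by (simp add: power_divide divide_le_eq)
  moreover have "exp (- 1) \<le> (10 / 27 :: real)"
  proof -
    \<comment> \<open>The quadratic Taylor bound at 1/8, raised to the eighth power, already gives e
      \<ge> 2.7.\<close>
    have "27 / 10 \<le> (1 + 1 / 8 + (1 / 8)\<^sup>2 / 2 :: real) ^ 8"
      by (simp add: power_divide eval_nat_numeral)
    also have "\<dots> \<le> exp (1 / 8) ^ 8"
      by (intro power_mono exp_lower_Taylor_quadratic) auto
    also have "\<dots> = exp 1"
      by (subst exp_of_nat_mult[symmetric]) simp
    finally show ?thesis
      by (simp add: exp_minus field_simps)
  qed
  ultimately have e: "real k ^ (k + 1) \<le> 10 / 27 * (real k + 1) ^ (k + 1)"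
    by (smt (verit) mult_right_mono zero_le_power of_nat_0_le_iff)
  have cub: "4 * (real k)\<^sup>2 \<le> (real k + 1) ^ 3"
  proof -
    have "(real k) ^ 3 - (real k)\<^sup>2 \<ge> 0"
      using step by (simp add: power3_eq_cube power2_eq_square)
    then show ?thesis by (simp add: power3_eq_cube power2_eq_square algebra_simps)
  qed
  have "real k ^ (2 * k + 4) = (real k)\<^sup>2 * (real k ^ (k + 1))\<^sup>2"
    unfolding power_mult[symmetric] power_add[symmetric] by (intro arg_cong2[of _ _ _ _ power]) auto
  then have "324 * (real k + 1) * real k ^ (2 * k + 4) = 324 * (real k + 1) * (real k)\<^sup>2 * (real k ^ (k + 1))\<^sup>2"
    by simp
  also have "\<dots> \<le> 324 * (real k + 1) * ((real k + 1) ^ 3 / 4) * (10 / 27 * (real k + 1) ^ (k + 1))\<^sup>2"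
    using e cub by (intro mult_mono power_mono) auto
  also have "\<dots> = 100 / 9 * ((real k + 1) ^ 4 * ((real k + 1) ^ (k + 1))\<^sup>2)"
    unfolding power_mult_distrib by (simp add: power_divide power4_eq_xxxx power3_eq_cube)
  also have "\<dots> = 100 / 9 * real (Suc k) ^ (2 * Suc k + 4)"
    unfolding power_mult[symmetric] power_add[symmetric] by (simp add: ac_simps)
  also have "\<dots> \<le> 23 / 2 * (real (Suc k)) ^ (2 * Suc k + 4)"
    by (intro mult_right_mono) auto
  finally have A: "324 * (real k + 1) * real k ^ (2 * k + 4) \<le> 23 / 2 * (real (Suc k)) ^ (2 * Suc k + 4)" .
  have "128 * 324 ^ (Suc k - 1) * fact (Suc k) = 324 * (real k + 1) * (128 * 324 ^ (k - 1) * fact k)"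
    using step by (cases k) (simp_all add: algebra_simps)
  also have "\<dots> \<le> 324 * (real k + 1) * (36 * real k ^ (2 * k + 4) * (23 / 2) ^ k)"
    using step by (intro mult_left_mono) auto
  also have "\<dots> = 36 * (23 / 2) ^ k * (324 * (real k + 1) * real k ^ (2 * k + 4))"
    by simp
  also have "\<dots> \<le> 36 * (23 / 2) ^ k * (23 / 2 * (real (Suc k)) ^ (2 * Suc k + 4))"
    using A by (intro mult_left_mono) auto
  finally show ?case by (simp add: mult_ac)
qed

text \<open>The factor sqrt 6 + 2 sqrt 3 = sqrt 3 (sqrt 2 + 2) absorbs sqrt 3^k, and the exponent of
  k equals k + 2 + 1/(2k), hence is at least k + 2. What remains is compared after squaring.\<close>

lemma pauli_const_bound:
  assumes "k \<ge> 1"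
  shows "pauli_const k * (8 * 18 ^ (k - 1) * sqrt 3 ^ k) \<le> 3"
proof -
  define E where "E = real k powr (real k + 3 / 2 + (real k + 1) / (2 * real k))"
  have "real k ^ (k + 2) = real k powr (real (k + 2))"
    using assms by (intro powr_realpow[symmetric]) auto
  also have "\<dots> \<le> E"
    unfolding E_def using assms by (intro powr_mono) (auto simp: field_simps)
  finally have E: "real k ^ (k + 2) \<le> E" .
  have E0: "0 < E"
    using assms by (simp add: E_def)
  have s2: "23 / 2 \<le> (sqrt 2 + 2)\<^sup>2"
  proof -
    have "11 / 8 \<le> sqrt 2"
      by (rule real_le_rsqrt) (simp add: power2_eq_square)
    then show ?thesis
      by (simp add: power2_eq_square algebra_simps)
  qed
  have "(sqrt (2 * fact k) * (8 * 18 ^ (k - 1)))\<^sup>2 = 128 * 324 ^ (k - 1) * fact k"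
    by (simp add: power_mult_distrib power2_eq_square[of "18 ^ _"] flip: power_mult_distrib[of _ "18 :: real"])
  also have "\<dots> \<le> 36 * real k ^ (2 * k + 4) * (23 / 2) ^ k"
    by (rule factorial_growth_bound[OF assms])
  also have "\<dots> \<le> 36 * real k ^ (2 * k + 4) * ((sqrt 2 + 2)\<^sup>2) ^ k"
    using s2 by (intro mult_left_mono power_mono) auto
  also have "\<dots> = (6 * real k ^ (k + 2) * (sqrt 2 + 2) ^ k)\<^sup>2"
  proof -
    have "real k ^ (2 * k + 4) = (real k ^ (k + 2))\<^sup>2"
      unfolding power_mult[symmetric] by (intro arg_cong2[of _ _ _ _ power]) auto
    moreover have "((sqrt 2 + 2)\<^sup>2) ^ k = ((sqrt 2 + 2 :: real) ^ k)\<^sup>2"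
      unfolding power_mult[symmetric] by (simp only: mult.commute)
    ultimately show ?thesis
      by (simp only: power_mult_distrib) simp
  qed
  finally have "sqrt (2 * fact k) * (8 * 18 ^ (k - 1)) \<le> 6 * real k ^ (k + 2) * (sqrt 2 + 2) ^ k"
    by (rule power2_le_imp_le) auto
  also have "\<dots> \<le> 6 * E * (sqrt 2 + 2) ^ k"
    using E by (intro mult_right_mono mult_left_mono) auto
  finally have main: "sqrt (2 * fact k) * (8 * 18 ^ (k - 1)) \<le> 6 * E * (sqrt 2 + 2) ^ k" .
  have "sqrt 6 + 2 * sqrt 3 = sqrt 3 * (sqrt 2 + 2)"
    by (simp add: distrib_left mult.commute flip: real_sqrt_mult)
  then have "(sqrt 6 + 2 * sqrt 3) ^ k = sqrt 3 ^ k * (sqrt 2 + 2) ^ k"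
    by (simp add: power_mult_distrib)
  then have "pauli_const k * (8 * 18 ^ (k - 1) * sqrt 3 ^ k) =
      sqrt (2 * fact k) * (8 * 18 ^ (k - 1)) / (2 * E * (sqrt 2 + 2) ^ k)"
    unfolding pauli_const_def E_def[symmetric] by (simp add: mult_ac)
  also have "\<dots> \<le> 6 * E * (sqrt 2 + 2) ^ k / (2 * E * (sqrt 2 + 2) ^ k)"
    using E0 main by (intro divide_right_mono) auto
  also have "\<dots> = 3"
    using E0 add_pos_pos[of "sqrt 2" 2] by simp
  finally show ?thesis .
qed

theorem corollary11:
  fixes H :: "'n::finite operator" and k :: nat
  assumes "k \<ge> 1"
    and "local_hamiltonian k H"
  shows "1 / 3 * pauli_const k * pauli_norm (2 * real k / (real k + 1)) H \<le> spectral_norm H"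
proof -
  have "0 \<le> pauli_const k"
    by (simp add: pauli_const_def)
  then have "1 / 3 * pauli_const k * pauli_norm (2 * real k / (real k + 1)) H \<le>
      1 / 3 * pauli_const k * (8 * 18 ^ (k - 1) * sqrt 3 ^ k * spectral_norm H)"
    using pauli_norm_bound[OF assms] by (intro mult_left_mono) auto
  also have "\<dots> = (1 / 3 * (pauli_const k * (8 * 18 ^ (k - 1) * sqrt 3 ^ k))) * spectral_norm H"
    by simp
  also have "\<dots> \<le> 1 * spectral_norm H"
    using pauli_const_bound[OF assms(1)]
    by (intro mult_right_mono) (auto simp: spectral_norm_def intro!: onorm_pos_le)
  finally show ?thesis by simp
qed

end
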